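(* Fix integers $\ell\geq 1$ and $m\geq 1$. Then for every integer $n\ge 0$, $$\sum_{(k_1,\ldots,k_{2\ell})\in K(2\ell,\,n-\ell(m+\ell-1))}\ \prod_{j=0}^{2\ell-1} F_{k_{j+1}}^{(m+j)} = \sum_{(k_1,\ldots,k_\ell)\in K(\ell,n)}\ \prod_{j=0}^{\ell-1} \left(F^{(m+2j+1)}_{k_{j+1}}-F^{(m+2j)}_{k_{j+1}}\right)$$ and $$\sum_{(k_1,\ldots,k_{2\ell+1})\in K(2\ell+1,\,n-\ell(m+\ell-1))}\ \prod_{j=0}^{2\ell} F_{k_{j+1}}^{(m+j)}= \sum_{(k_1,\ldots,k_{\ell+1})\in K(\ell+1,n)}F_{k_{\ell+1}}^{(m+2\ell)}\prod_{j=0}^{\ell-1} \left(F^{(m+2j+1)}_{k_{j+1}}-F^{(m+2j)}_{k_{j+1}}\right).$$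
   Context: For each integer $m\ge 1$ the Fibonacci $m$-step numbers $F_n^{(m)}$ are defined by $F_n^{(m)}=0$ for $n=-(m-2),\ldots,0$ (with $F_0^{(1)}=0$ when $m=1$), $F_1^{(m)}=1$, and $F_n^{(m)}=\sum_{j=1}^m F_{n-j}^{(m)}$ for all $n\ge 2$. Notation: $K(\ell,b)=\{(k_1,\ldots,k_\ell)\in\mathbb{Z}_{\ge 0}^\ell : k_1+\cdots+k_\ell=b\}$, which is empty for $b<0$; empty sums are $0$. *)

theory Defs
  imports Main
begin

declare sum.cong [fundef_cong]

text \<open>
  \<open>fib_step m n\<close> is \<open>F\<^sub>n\<close> with superscript \<open>(m)\<close>, for \<open>m \<ge> 1\<close>. The index is an integer, because for
  small \<open>n\<close> the recurrence reaches the initial zeros at \<open>-(m - 2), \<dots>, 0\<close>; the value \<open>0\<close> below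
  \<open>-(m - 2)\<close> is only a totality convention and is never reached from there. The values are
  integers so that subtraction is not truncated.
\<close>
function fib_step :: "nat \<Rightarrow> int \<Rightarrow> int" where
  "fib_step m n =
     (if n \<le> 0 then 0
      else if n = 1 then 1
      else (\<Sum>j = 1..m. fib_step m (n - int j)))"
  by pat_completeness auto
termination
  by (relation "measure (\<lambda>(m, n). nat n)") auto

declare fib_step.simps [simp del]

text \<open>Tuples are lists, so \<open>k\<^sub>j\<^sub>+\<^sub>1\<close> is \<open>ks ! j\<close>. The integer \<open>b\<close> may be negative.\<close>
definition K :: "nat \<Rightarrow> int \<Rightarrow> nat list set" where
  "K l b = {ks. length ks = l \<and> int (sum_list ks) = b}"

lemma finite_K: "finite (K l b)"
proof (rule finite_subset)
  show "K l b \<subseteq> {ks. set ks \<subseteq> {0..nat b} \<and> length ks = l}"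
    by (auto simp: K_def dest: member_le_sum_list)
  show "finite {ks. set ks \<subseteq> {0..nat b} \<and> length ks = l}"
    by (rule finite_lists_length_eq) simp
qed

lemma K_neg: "b < 0 \<Longrightarrow> K l b = {}"
  by (auto simp: K_def)

end

theory Submission
  imports Defs "HOL-Computational_Algebra.Formal_Power_Series"
begin

text \<open>
  Both identities compare coefficients in an identity of formal power series. The recurrence says that
  \<open>G\<^sub>m = \<Sum>\<^sub>n F\<^sub>n x\<^sup>n\<close> satisfies \<open>G\<^sub>m D\<^sub>m = x\<close> with \<open>D\<^sub>m = 1 - x - \<dots> - x\<^sup>m\<close>. Consecutive
  denominators differ by the single monomial \<open>D\<^sub>m - D\<^sub>m\<^sub>+\<^sub>1 = x\<^bsup>m+1\<^esup>\<close>, so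
  \<open>G\<^sub>m\<^sub>+\<^sub>1 - G\<^sub>m = x (D\<^sub>m - D\<^sub>m\<^sub>+\<^sub>1) / (D\<^sub>m D\<^sub>m\<^sub>+\<^sub>1) = x\<^sup>m G\<^sub>m G\<^sub>m\<^sub>+\<^sub>1\<close>: a difference of neighbours is their
  product up to a shift (\<open>fib_gf_diff\<close>).

  Multiplying this over the pairs \<open>(m + 2 j, m + 2 j + 1)\<close> with \<open>j < l\<close> gives the product of the
  \<open>2 l\<close> consecutive series times \<open>x\<close> to the power \<open>\<Sum>\<^sub>j (m + 2 j) = l (m + l - 1)\<close>
  (\<open>prod_fib_gf_diff\<close>). The sums over \<open>K\<close> are the coefficients of such products, and the power of
  \<open>x\<close> is the shift of the index \<open>n\<close> (\<open>sum_K_prod_nth\<close>). The second identity is the first one with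
  the additional factor \<open>G\<^bsub>m+2l\<^esub>\<close> on both sides.
\<close>

unbundle fps_syntax

definition fib_gf :: "nat \<Rightarrow> int fps" where
  "fib_gf m = Abs_fps (\<lambda>n. fib_step m (int n))"

lemma fib_gf_nth: "fib_gf m $ n = fib_step m (int n)"
  by (simp add: fib_gf_def)

text \<open>
  Since the sequence vanishes at all indices \<open>\<le> 0\<close>, the truncated convolution with \<open>x + \<dots> + x\<^sup>m\<close> is
  the full sum of the recurrence. The recurrence fails only at the initial value \<open>F\<^sub>1 = 1\<close>, which
  leaves \<open>x\<close>.
\<close>

lemma fib_gf_mult_denominator:
  "fib_gf m * (1 - (\<Sum>j = 1..m. fps_X ^ j)) = fps_X"
proof (rule fps_ext)
  fix n
  have shift: "(if n < j then 0 else fib_gf m $ (n - j)) = fib_step m (int n - int j)" for j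
    by (cases "n \<le> j")
      (auto simp: fib_gf_nth fib_step.simps[of m 0] fib_step.simps[of m "int n - int j"]
        of_nat_diff)
  have "(fib_gf m * (1 - (\<Sum>j = 1..m. fps_X ^ j))) $ n
          = fib_step m (int n) - (\<Sum>j = 1..m. fib_step m (int n - int j))"
    by (simp add: algebra_simps sum_distrib_left fps_sum_nth fps_X_power_mult_right_nth
        shift) (simp add: fib_gf_nth)
  also have "\<dots> = fps_X $ n"
  proof (cases "n \<le> 1")
    case True
    have "(\<Sum>j = 1..m. fib_step m (int n - int j)) = 0"
      using True by (intro sum.neutral) (auto simp: fib_step.simps)
    with True show ?thesis by (auto simp: fib_step.simps[of m "int n"] fps_X_def)
  next
    case False
    then show ?thesis by (simp add: fib_step.simps[of m "int n"] fps_X_def)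
  qed
  finally show "(fib_gf m * (1 - (\<Sum>j = 1..m. fps_X ^ j))) $ n = fps_X $ n" .
qed

text \<open>
  The factor \<open>x\<close> on the left can be rewritten as \<open>G\<^sub>m D\<^sub>m\<close> in one term and as \<open>G\<^sub>m\<^sub>+\<^sub>1 D\<^sub>m\<^sub>+\<^sub>1\<close> in the
  other, so \<open>x (G\<^sub>m\<^sub>+\<^sub>1 - G\<^sub>m) = G\<^sub>m G\<^sub>m\<^sub>+\<^sub>1 (D\<^sub>m - D\<^sub>m\<^sub>+\<^sub>1)\<close>. The right-hand side is divisible by \<open>x\<close>, and
  cancelling it replaces the division of power series.
\<close>

lemma fib_gf_diff:
  "fib_gf (Suc m) - fib_gf m = fps_X ^ m * (fib_gf m * fib_gf (Suc m))"
proof -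
  define D where "D m = (1 - (\<Sum>j = 1..m. fps_X ^ j) :: int fps)" for m
  have GD: "fib_gf m * D m = fps_X" for m
    unfolding D_def by (rule fib_gf_mult_denominator)
  have "D m - D (Suc m) = fps_X ^ Suc m"
    by (simp add: D_def)
  have "fps_X * (fib_gf (Suc m) - fib_gf m)
          = (fib_gf m * D m) * fib_gf (Suc m) - (fib_gf (Suc m) * D (Suc m)) * fib_gf m"
    unfolding GD by (rule right_diff_distrib)
  also have "\<dots> = fib_gf m * fib_gf (Suc m) * (D m - D (Suc m))"
    by (simp add: algebra_simps)
  also have "\<dots> = fps_X * (fps_X ^ m * (fib_gf m * fib_gf (Suc m)))"
    unfolding \<open>D m - D (Suc m) = fps_X ^ Suc m\<close> by (simp add: mult_ac)
  finally show ?thesis by simp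
qed

lemma prod_fib_gf_diff:
  "(\<Prod>j<l. fib_gf (m + 2 * j + 1) - fib_gf (m + 2 * j))
     = fps_X ^ (l * m + l * (l - 1)) * (\<Prod>j<2 * l. fib_gf (m + j))"
proof (induction l)
  case 0
  show ?case by simp
next
  case (Suc l)
  let ?s = "l * m + l * (l - 1)"
  have exponent: "Suc l * m + Suc l * (Suc l - 1) = ?s + (m + 2 * l)"
    by (cases l) (auto simp: algebra_simps)
  have "(\<Prod>j<Suc l. fib_gf (m + 2 * j + 1) - fib_gf (m + 2 * j))
          = (fps_X ^ ?s * (\<Prod>j<2 * l. fib_gf (m + j)))
            * (fps_X ^ (m + 2 * l) * (fib_gf (m + 2 * l) * fib_gf (Suc (m + 2 * l))))"
    using Suc.IH fib_gf_diff[of "m + 2 * l"] by simp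
  also have "\<dots> = fps_X ^ (?s + (m + 2 * l)) * (\<Prod>j<2 * Suc l. fib_gf (m + j))"
    unfolding power_add[of _ ?s] by (simp add: mult.assoc mult.left_commute)
  finally show ?case
    unfolding exponent .
qed

text \<open>
  For \<open>s \<le> n\<close> the set \<open>K\<close> indexes exactly the terms of the Cauchy product; for \<open>s > n\<close> it is empty,
  in agreement with the vanishing low coefficients of a multiple of \<open>x\<^sup>s\<close>. The case \<open>s = 0\<close> serves the
  right-hand sides of the theorem.
\<close>

lemma sum_K_prod_nth:
  fixes a :: "nat \<Rightarrow> int fps"
  shows "(\<Sum>ks \<in> K (Suc k) (int n - int s). \<Prod>j = 0..k. a j $ (ks ! j))
           = (fps_X ^ s * (\<Prod>j<Suc k. a j)) $ n"
proof (cases "n < s")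
  case True
  then show ?thesis by (simp add: K_neg fps_X_power_mult_nth)
next
  case False
  then have "K (Suc k) (int n - int s) = natpermute (n - s) (k + 1)"
    by (auto simp: K_def natpermute_def)
  moreover have "{..<Suc k} = {0..k}"
    by auto
  ultimately show ?thesis
    using False by (simp add: fps_X_power_mult_nth fps_prod_nth)
qed

theorem theorem4p1:
  fixes l m n :: nat
  assumes "l \<ge> 1" and "m \<ge> 1"
  shows "(\<Sum>ks \<in> K (2 * l) (int n - int l * (int m + int l - 1)).
            \<Prod>j = 0..2 * l - 1. fib_step (m + j) (int (ks ! j)))
         = (\<Sum>ks \<in> K l (int n).
            \<Prod>j = 0..l - 1. (fib_step (m + 2 * j + 1) (int (ks ! j))
                - fib_step (m + 2 * j) (int (ks ! j))))
       \<and> (\<Sum>ks \<in> K (2 * l + 1) (int n - int l * (int m + int l - 1)).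
            \<Prod>j = 0..2 * l. fib_step (m + j) (int (ks ! j)))
         = (\<Sum>ks \<in> K (l + 1) (int n).
            fib_step (m + 2 * l) (int (ks ! l)) *
            (\<Prod>j = 0..l - 1. (fib_step (m + 2 * j + 1) (int (ks ! j))
                - fib_step (m + 2 * j) (int (ks ! j)))))"
proof -
  define s where "s = l * m + l * (l - 1)"
  define d where "d j = fib_gf (m + 2 * j + 1) - fib_gf (m + 2 * j)" for j
  have shift: "int l * (int m + int l - 1) = int s"
    using assms(1) by (cases l) (simp_all add: s_def algebra_simps)
  have d_nth: "d j $ k = fib_step (m + 2 * j + 1) (int k) - fib_step (m + 2 * j) (int k)" for j k
    by (simp add: d_def fib_gf_nth)
  have d_prod: "(\<Prod>j<l. d j) = fps_X ^ s * (\<Prod>j<2 * l. fib_gf (m + j))"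
    unfolding d_def s_def by (rule prod_fib_gf_diff)

  have "(\<Sum>ks \<in> K (2 * l) (int n - int s). \<Prod>j = 0..2 * l - 1. fib_gf (m + j) $ (ks ! j))
          = (\<Sum>ks \<in> K l (int n). \<Prod>j = 0..l - 1. d j $ (ks ! j))"
    using sum_K_prod_nth[of "\<lambda>j. fib_gf (m + j)" "2 * l - 1" n s]
      sum_K_prod_nth[of d "l - 1" n 0] d_prod assms(1)
    by simp
  moreover
  \<comment> \<open>The extra factor becomes the last one of a family indexed by \<open>{0..l}\<close>.\<close>
  define e where "e = d(l := fib_gf (m + 2 * l))"
  have e_prod: "(\<Prod>j<Suc l. e j) = fps_X ^ s * (\<Prod>j<Suc (2 * l). fib_gf (m + j))"
    by (simp add: e_def d_prod mult.assoc)
  have e_nth: "(\<Prod>j = 0..l. e j $ (ks ! j))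
      = fib_gf (m + 2 * l) $ (ks ! l) * (\<Prod>j = 0..l - 1. d j $ (ks ! j))" for ks
  proof -
    have "{0..l} = insert l {0..l - 1}" "l \<notin> {0..l - 1}"
      using assms(1) by auto
    moreover from this have "(\<Prod>j = 0..l - 1. e j $ (ks ! j)) = (\<Prod>j = 0..l - 1. d j $ (ks ! j))"
      by (intro prod.cong) (auto simp: e_def)
    ultimately show ?thesis
      by (simp add: e_def)
  qed
  have "(\<Sum>ks \<in> K (2 * l + 1) (int n - int s). \<Prod>j = 0..2 * l. fib_gf (m + j) $ (ks ! j))
          = (\<Sum>ks \<in> K (l + 1) (int n).
              fib_gf (m + 2 * l) $ (ks ! l) * (\<Prod>j = 0..l - 1. d j $ (ks ! j)))"
    using sum_K_prod_nth[of "\<lambda>j. fib_gf (m + j)" "2 * l" n s]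
      sum_K_prod_nth[of e l n 0]
    unfolding e_prod e_nth by simp
  ultimately show ?thesis
    unfolding shift d_nth fib_gf_nth by blast
qed

end
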